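(* Let $F$ be an arbitrary field, let $N\ge 2$ be an integer, let $G$ be an abelian group, and let $\mathcal{L}=\bigoplus_{\alpha\in G}\mathcal{L}_\alpha$ be a finitely generated $G$-graded Lie algebra over $F$. Then $$\mathrm{Der}^{(N)}(\mathcal{L})=\bigoplus_{\alpha\in G}\mathrm{Der}^{(N)}_\alpha(\mathcal{L}).$$
   Context: For elements $x_1,\dots,x_n$ of a Lie algebra $\mathcal{L}$ write $[x_1,\dots,x_{n-1},x_n]=[x_1,[x_2,\cdots[x_{n-2},[x_{n-1},x_n]]\cdots]]$ (right-nested bracket). For an integer $N\ge 2$, an $N$-derivation of $\mathcal{L}$ is an $F$-linear map $\varphi:\mathcal{L}\to\mathcal{L}$ such that $$\varphi([x_1,\dots,x_N])=\sum_{i=1}^N[x_1,\dots,x_{i-1},\varphi(x_i),x_{i+1},\dots,x_N]\quad\text{for all }x_1,\dots,x_N\in\mathcal{L}.$$ $\mathrm{Der}^{(N)}(\mathcal{L})$ denotes the space of all $N$-derivations of $\mathcal{L}$. If $\mathcal{L}=\bigoplus_{\alpha\in G}\mathcal{L}_\alpha$ is $G$-graded (so $[\mathcal{L}_\alpha,\mathcal{L}_\beta]\subseteq\mathcal{L}_{\alpha+\beta}$), an $N$-derivation $\varphi$ is of homogeneous degree $\alpha\in G$ if $\varphi(\mathcal{L}_\beta)\subseteq\mathcal{L}_{\alpha+\beta}$ for all $\beta\in G$, and $\mathrm{Der}^{(N)}_\alpha(\mathcal{L})$ denotes the space of $N$-derivations of homogeneous degree $\alpha$. "Finitely generated" means finitely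 generated as a Lie algebra. *)

theory Defs
  imports Complex_Main "HOL-Library.Function_Algebras"
begin

text \<open>\<open>W\<close> is the internal direct sum of the subspaces \<open>V i\<close>. The index type may be infinite; each
  element of \<open>W\<close> has a unique finitely supported family of components.\<close>

definition is_direct_sum ::
    "('f::field \<Rightarrow> 'v::ab_group_add \<Rightarrow> 'v) \<Rightarrow> 'v set \<Rightarrow> ('i \<Rightarrow> 'v set) \<Rightarrow> bool" where
  "is_direct_sum scale W V \<longleftrightarrow>
     module.subspace scale W \<and>
     (\<forall>i. module.subspace scale (V i) \<and> V i \<subseteq> W) \<and>
     (\<forall>w\<in>W. \<exists>!v. (\<forall>i. v i \<in> V i) \<and> finite {i. v i \<noteq> 0} \<and> w = (\<Sum>i | v i \<noteq> 0. v i))"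

definition fun_scale :: "('f \<Rightarrow> 'v \<Rightarrow> 'v) \<Rightarrow> 'f \<Rightarrow> ('a \<Rightarrow> 'v) \<Rightarrow> 'a \<Rightarrow> 'v" where
  "fun_scale scale c f = (\<lambda>x. scale c (f x))"

lemma vector_space_fun_scale:
  assumes "vector_space scale"
  shows "vector_space (fun_scale scale)"
proof -
  interpret vector_space scale by fact
  show ?thesis
    by unfold_locales (auto simp: fun_scale_def fun_eq_iff scale_right_distrib scale_left_distrib)
qed

text \<open>Characteristic 2 is allowed, so the bracket is required to be alternating and not merely
  antisymmetric.\<close>

locale lie_algebra = vector_space scale
  for scale :: "'f::field \<Rightarrow> 'a::ab_group_add \<Rightarrow> 'a" +
  fixes bracket :: "'a \<Rightarrow> 'a \<Rightarrow> 'a"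
  assumes bracket_linear_left: "Vector_Spaces.linear scale scale (\<lambda>x. bracket x y)"
    and bracket_linear_right: "Vector_Spaces.linear scale scale (\<lambda>y. bracket x y)"
    and bracket_alternating: "bracket x x = 0"
    and jacobi: "bracket x (bracket y z) + bracket y (bracket z x) + bracket z (bracket x y) = 0"
begin

definition lie_subalgebra :: "'a set \<Rightarrow> bool" where
  "lie_subalgebra S \<longleftrightarrow> subspace S \<and> (\<forall>x\<in>S. \<forall>y\<in>S. bracket x y \<in> S)"

definition finitely_generated :: bool where
  "finitely_generated \<longleftrightarrow> (\<exists>X. finite X \<and> lie_subalgebra hull X = UNIV)"

text \<open>Right-nested bracket of a nonempty list; the value on \<open>[]\<close> is a dummy.\<close>

fun nested_bracket :: "'a list \<Rightarrow> 'a" where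
  "nested_bracket [] = 0"
| "nested_bracket [x] = x"
| "nested_bracket (x # y # ys) = bracket x (nested_bracket (y # ys))"

definition Der :: "nat \<Rightarrow> ('a \<Rightarrow> 'a) set" where
  "Der N = {\<phi>. Vector_Spaces.linear scale scale \<phi> \<and>
     (\<forall>xs. length xs = N \<longrightarrow>
        \<phi> (nested_bracket xs) = (\<Sum>i<N. nested_bracket (xs[i := \<phi> (xs ! i)])))}"

end

locale graded_lie_algebra = lie_algebra scale bracket
  for scale :: "'f::field \<Rightarrow> 'a::ab_group_add \<Rightarrow> 'a"
    and bracket :: "'a \<Rightarrow> 'a \<Rightarrow> 'a" +
  fixes L :: "'g::ab_group_add \<Rightarrow> 'a set"
  assumes grading: "is_direct_sum scale UNIV L"
    and bracket_graded: "x \<in> L \<alpha> \<Longrightarrow> y \<in> L \<beta> \<Longrightarrow> bracket x y \<in> L (\<alpha> + \<beta>)"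
begin

definition Der_deg :: "nat \<Rightarrow> 'g \<Rightarrow> ('a \<Rightarrow> 'a) set" where
  "Der_deg N \<alpha> = {\<phi> \<in> Der N. \<forall>\<beta>. \<phi> ` L \<beta> \<subseteq> L (\<alpha> + \<beta>)}"

end

end

theory Submission imports Defs begin

text \<open>Decompose \<open>\<phi>\<close> into the maps \<open>\<phi>\<^sub>\<alpha>\<close> sending a homogeneous \<open>x\<close> of degree \<open>\<beta>\<close> to the component of
  \<open>\<phi> x\<close> of degree \<open>\<alpha> + \<beta>\<close>. By multilinearity it is enough to test the \<open>N\<close>-derivation identity for
  \<open>\<phi>\<^sub>\<alpha>\<close> on homogeneous arguments, where it is the component of the identity for \<open>\<phi>\<close>. At a single
  element only finitely many \<open>\<phi>\<^sub>\<alpha>\<close> do not vanish. The Lie algebra is spanned by the right-nested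
  monomials in a finite generating set \<open>X\<close>, and a monomial of length at least \<open>N\<close> is an \<open>N\<close>-fold
  bracket of elements of \<open>X\<close> and one shorter monomial. Hence an \<open>N\<close>-derivation is determined by
  its values on the finitely many monomials of length less than \<open>N\<close>, so almost all \<open>\<phi>\<^sub>\<alpha>\<close> vanish.\<close>

lemma sum_fun_apply: "(\<Sum>i\<in>A. f i) x = (\<Sum>i\<in>A. f i x)"
  for f :: "'i \<Rightarrow> 'a \<Rightarrow> 'b::comm_monoid_add"
  by (induction A rule: infinite_finite_induct) auto

section \<open>Nested brackets and \<open>N\<close>-derivations\<close>

context lie_algebra
begin

interpretation vs: vector_space_pair scale scale
  by unfold_locales

lemma bracket_add_left: "bracket (x + y) z = bracket x z + bracket y z"
  and bracket_scale_left: "bracket (scale c x) z = scale c (bracket x z)"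
  and bracket_zero_left: "bracket 0 z = 0"
  using vs.linear_add[OF bracket_linear_left] vs.linear_scale[OF bracket_linear_left]
    vs.linear_0[OF bracket_linear_left] by auto

lemma bracket_add_right: "bracket z (x + y) = bracket z x + bracket z y"
  and bracket_scale_right: "bracket z (scale c x) = scale c (bracket z x)"
  and bracket_zero_right: "bracket z 0 = 0"
  and bracket_sum_right: "bracket z (sum f A) = (\<Sum>i\<in>A. bracket z (f i))"
  using vs.linear_add[OF bracket_linear_right] vs.linear_scale[OF bracket_linear_right]
    vs.linear_0[OF bracket_linear_right] vs.linear_sum[OF bracket_linear_right] by auto

lemma bracket_anticommute: "bracket x y = - bracket y x"
proof -
  have "0 = bracket (x + y) (x + y)"
    by (simp only: bracket_alternating)
  also have "\<dots> = bracket x y + bracket y x"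
    unfolding bracket_add_left bracket_add_right by (simp add: bracket_alternating)
  finally show ?thesis
    by (simp add: eq_neg_iff_add_eq_0)
qed

text \<open>Jacobi in the form that bracketing with \<open>bracket x y\<close> is the commutator of
  bracketing with \<open>x\<close> and with \<open>y\<close>. It turns left-nested brackets into
  right-nested ones.\<close>

lemma bracket_bracket_left: "bracket (bracket x y) z = bracket x (bracket y z) - bracket y (bracket x z)"
proof -
  have "bracket y (bracket z x) = - bracket y (bracket x z)"
    using vs.linear_neg[OF bracket_linear_right, of y "bracket x z"] bracket_anticommute[of z x] by simp
  then show ?thesis
    using jacobi[of x y z] bracket_anticommute[of "bracket x y" z]
    by (simp add: eq_diff_eq add_eq_0_iff algebra_simps)
qed

lemma nested_bracket_Cons:
  "xs \<noteq> [] \<Longrightarrow> nested_bracket (x # xs) = bracket x (nested_bracket xs)"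
  by (cases xs) auto

text \<open>Collapsing a tail into one entry lets a long monomial be read as a bracket of exactly
  \<open>N\<close> entries.\<close>

lemma nested_bracket_append:
  "ys \<noteq> [] \<Longrightarrow> nested_bracket (xs @ ys) = nested_bracket (xs @ [nested_bracket ys])"
  by (induction xs) (auto simp: nested_bracket_Cons)

text \<open>Multilinearity, with \<open>xs[k := y]\<close> selecting the slot. The head slot uses
  linearity of the bracket on the left; later slots compose with \<open>bracket x\<close>.\<close>

lemma linear_nested_bracket:
  assumes "k < length xs"
  shows "Vector_Spaces.linear scale scale (\<lambda>y. nested_bracket (xs[k := y]))"
  using assms
proof (induction xs arbitrary: k)
  case Nil
  then show ?case by simp
next
  case (Cons x xs)
  show ?case
  proof (cases "xs = []")
    case True
    with Cons show ?thesis by (simp add: linear_ident)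
  next
    case xs: False
    show ?thesis
    proof (cases k)
      case 0
      with xs show ?thesis by (simp add: nested_bracket_Cons bracket_linear_left)
    next
      case (Suc j)
      with Cons have "Vector_Spaces.linear scale scale (\<lambda>y. nested_bracket (xs[j := y]))"
        by simp
      from Vector_Spaces.linear_compose[OF this bracket_linear_right[of x]] Suc xs
      show ?thesis by (simp add: nested_bracket_Cons o_def)
    qed
  qed
qed

lemma DerD:
  assumes "\<phi> \<in> Der N"
  shows "Vector_Spaces.linear scale scale \<phi>"
    and "length xs = N \<Longrightarrow>
      \<phi> (nested_bracket xs) = (\<Sum>i<N. nested_bracket (xs[i := \<phi> (xs ! i)]))"
  using assms by (auto simp: Der_def)

text \<open>Each summand of the identity contains \<phi> in exactly one slot, so the identity is
  linear in \<phi>.\<close>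

lemma subspace_Der: "module.subspace (fun_scale scale) (Der N)"
proof -
  interpret F: vector_space "fun_scale scale"
    by (rule vector_space_fun_scale) unfold_locales
  have zero: "0 \<in> Der N"
    using vs.linear_0[OF linear_nested_bracket]
    by (auto simp: Der_def vs.linear_zero zero_fun_def)
  have add: "\<phi> + \<psi> \<in> Der N" if "\<phi> \<in> Der N" "\<psi> \<in> Der N" for \<phi> \<psi>
    using that vs.linear_add[OF linear_nested_bracket]
    by (auto simp: Der_def vs.linear_compose_add plus_fun_def sum.distrib)
  have scale: "fun_scale scale c \<phi> \<in> Der N" if "\<phi> \<in> Der N" for c \<phi>
    using that vs.linear_scale[OF linear_nested_bracket]
    by (auto simp: Der_def vs.linear_compose_scale_right fun_scale_def scale_sum_right)
  show ?thesis
    using zero add scale by (auto simp: F.subspace_def)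
qed

text \<open>Both sides of the identity are multilinear in the entries, so entries from
  \<open>B\<close> can be replaced by arbitrary ones, one position at a time.\<close>

lemma Der_if_spanning:
  assumes lin: "Vector_Spaces.linear scale scale \<phi>"
    and span: "span B = UNIV"
    and der: "\<And>xs. length xs = N \<Longrightarrow> set xs \<subseteq> B \<Longrightarrow>
      \<phi> (nested_bracket xs) = (\<Sum>i<N. nested_bracket (xs[i := \<phi> (xs ! i)]))"
  shows "\<phi> \<in> Der N"
proof -
  \<comment> \<open>The first \<open>k\<close> entries are arbitrary and the others lie in
    \<open>B\<close>; \<open>k = 0\<close> is the hypothesis and \<open>k = N\<close> the
    claim.\<close>
  have *: "\<phi> (nested_bracket xs) = (\<Sum>i<N. nested_bracket (xs[i := \<phi> (xs ! i)]))"
    if "length xs = N" "set (drop k xs) \<subseteq> B" for k xs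
    using that
  proof (induction k arbitrary: xs)
    case 0
    with der show ?case by simp
  next
    case (Suc k)
    show ?case
    proof (cases "k < N")
      case False
      with Suc show ?thesis by simp
    next
      case True
      \<comment> \<open>The two sides as functions of entry \<open>k\<close> alone: both are linear,
        and they agree on \<open>B\<close>.\<close>
      define f where "f y = \<phi> (nested_bracket (xs[k := y]))" for y
      define g where
        "g y = (\<Sum>i<N. nested_bracket (xs[k := y, i := \<phi> (xs[k := y] ! i)]))" for y
      have "Vector_Spaces.linear scale scale f"
        using Vector_Spaces.linear_compose[OF linear_nested_bracket[of k xs] lin] True Suc.prems
        by (simp add: f_def[abs_def] o_def)
      moreover have "Vector_Spaces.linear scale scale g"
        unfolding g_def[abs_def]
      proof (rule vs.linear_compose_sum, rule ballI)
        fix i assume "i \<in> {..<N}"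
        show "Vector_Spaces.linear scale scale
          (\<lambda>y. nested_bracket (xs[k := y, i := \<phi> (xs[k := y] ! i)]))"
        proof (cases "i = k")
          case i: True
          then show ?thesis
            using Vector_Spaces.linear_compose[OF lin linear_nested_bracket[of k xs]] True Suc.prems
            by (simp add: o_def)
        next
          case False
          \<comment> \<open>The two updates commute, so \<open>y\<close> occupies one slot of a list
            that does not depend on \<open>y\<close>.\<close>
          then have "xs[k := y, i := \<phi> (xs[k := y] ! i)] = xs[i := \<phi> (xs ! i), k := y]" for y
            by (simp add: list_update_swap[of k i])
          then show ?thesis
            using linear_nested_bracket[of k "xs[i := \<phi> (xs ! i)]"] True Suc.prems
            by simp
        qed
      qed
      moreover have "f b = g b" if "b \<in> B" for b
      proof -
        have "drop k (xs[k := b]) = b # drop (Suc k) xs"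
          using True Suc.prems by (simp add: Cons_nth_drop_Suc[symmetric] drop_update_swap)
        then show ?thesis
          using Suc.IH[of "xs[k := b]"] Suc.prems that by (simp add: f_def g_def)
      qed
      ultimately have "f (xs ! k) = g (xs ! k)"
        using vs.linear_eq_on[of f g "xs ! k" B] span by simp
      then show ?thesis
        by (simp add: f_def g_def)
    qed
  qed
  show ?thesis
    using lin *[where k = N] by (auto simp: Der_def)
qed

section \<open>Monomials in a generating set\<close>

definition monomials :: "'a set \<Rightarrow> 'a set" where
  "monomials X = {nested_bracket xs | xs. xs \<noteq> [] \<and> set xs \<subseteq> X}"

lemma bracket_generator_span_monomials:
  assumes "x \<in> X" "v \<in> span (monomials X)"
  shows "bracket x v \<in> span (monomials X)"
  using assms(2)
proof (induction rule: span_induct)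
  case base
  show ?case
    by (auto simp: subspace_def bracket_zero_right bracket_add_right bracket_scale_right
        intro: span_zero span_add span_scale)
next
  case (step v)
  then obtain xs where "xs \<noteq> []" "set xs \<subseteq> X" "v = nested_bracket xs"
    by (auto simp: monomials_def)
  then have "bracket x v \<in> monomials X"
    unfolding monomials_def using assms(1)
    by (intro CollectI exI[of _ "x # xs"]) (auto simp: nested_bracket_Cons)
  then show ?case by (rule span_base)
qed

text \<open>Induction on the monomial: \<open>bracket_bracket_left\<close> splits off the leading
  generator. \<open>v\<close> is generalized because the hypothesis is also applied to
  \<open>bracket x v\<close>.\<close>

lemma bracket_monomial_span_monomials:
  assumes "xs \<noteq> []" "set xs \<subseteq> X" "v \<in> span (monomials X)"
  shows "bracket (nested_bracket xs) v \<in> span (monomials X)"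
  using assms
proof (induction xs arbitrary: v rule: list_nonempty_induct)
  case (single x)
  then show ?case by (simp add: bracket_generator_span_monomials)
next
  case (cons x xs)
  then have "bracket x (bracket (nested_bracket xs) v) \<in> span (monomials X)"
    and "bracket (nested_bracket xs) (bracket x v) \<in> span (monomials X)"
    by (simp_all add: bracket_generator_span_monomials)
  with cons(1) show ?case
    by (simp add: nested_bracket_Cons bracket_bracket_left span_diff)
qed

lemma bracket_span_monomials:
  assumes "u \<in> span (monomials X)" "v \<in> span (monomials X)"
  shows "bracket u v \<in> span (monomials X)"
  using assms(1)
proof (induction rule: span_induct)
  case base
  show ?case
    by (auto simp: subspace_def bracket_zero_left bracket_add_left bracket_scale_left
        intro: span_zero span_add span_scale)
next
  case (step u)
  then obtain xs where "xs \<noteq> []" "set xs \<subseteq> X" "u = nested_bracket xs"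
    by (auto simp: monomials_def)
  with assms(2) show ?case
    by (simp add: bracket_monomial_span_monomials)
qed

text \<open>The span of the right-nested monomials is closed under brackets and contains
  \<open>X\<close>, each generator being a monomial of length 1.\<close>

lemma lie_subalgebra_hull_subset_span_monomials:
  "lie_subalgebra hull X \<subseteq> span (monomials X)"
proof (rule hull_minimal)
  have "x \<in> monomials X" if "x \<in> X" for x
    unfolding monomials_def using that by (intro CollectI exI[of _ "[x]"]) auto
  then show "X \<subseteq> span (monomials X)"
    by (auto intro: span_base)
  show "lie_subalgebra (span (monomials X))"
    by (simp add: lie_subalgebra_def bracket_span_monomials)
qed

section \<open>Determination of \<open>N\<close>-derivations by short monomials\<close>

text \<open>Strong induction on length: a long monomial is an \<open>N\<close>-fold bracket whose
  entries are all annihilated by \<phi>, so every term of the derivation identity has a zero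
  entry.\<close>

lemma Der_vanishes_on_monomials:
  assumes der: "\<phi> \<in> Der N" and "N \<ge> 2"
    and short: "\<And>xs. set xs \<subseteq> X \<Longrightarrow> length xs < N \<Longrightarrow> \<phi> (nested_bracket xs) = 0"
    and "set xs \<subseteq> X"
  shows "\<phi> (nested_bracket xs) = 0"
  using \<open>set xs \<subseteq> X\<close>
proof (induction xs rule: length_induct)
  case (1 xs)
  show ?case
  proof (cases "length xs < N")
    case True
    with short 1 show ?thesis by blast
  next
    case False
    \<comment> \<open>The first \<open>N - 1\<close> generators leave the tail as the
      \<open>N\<close>-th entry; as \<open>N - 1 \<ge> 1\<close>, the tail is strictly shorter than
      \<open>xs\<close>.\<close>
    define us where "us = take (N - 1) xs"
    define vs where "vs = drop (N - 1) xs"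
    have len: "length us = N - 1" "vs \<noteq> []" "length vs < length xs"
      and xs: "xs = us @ vs"
      using False \<open>N \<ge> 2\<close> by (auto simp: us_def vs_def)
    define ys where "ys = us @ [nested_bracket vs]"
    have ys: "length ys = N"
      using len \<open>N \<ge> 2\<close> by (simp add: ys_def)
    \<comment> \<open>A generator is the monomial of \<open>[y]\<close>, of length 1 <
      \<open>N\<close>; the last entry is covered by the induction hypothesis.\<close>
    have "\<phi> y = 0" if "y \<in> set ys" for y
      using that 1 len xs short[of "[y]"] \<open>N \<ge> 2\<close> by (auto simp: ys_def)
    then have "nested_bracket (ys[i := \<phi> (ys ! i)]) = 0" if "i < N" for i
      using vs.linear_0[OF linear_nested_bracket] that ys by simp
    then have "\<phi> (nested_bracket ys) = 0"
      using DerD(2)[OF der ys] by simp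
    then show ?thesis
      using nested_bracket_append[of vs us] len xs by (simp add: ys_def)
  qed
qed

lemma Der_determined_by_finite_set:
  assumes finitely_generated and "N \<ge> 2"
  obtains Y where "finite Y" "\<And>\<phi>. \<phi> \<in> Der N \<Longrightarrow> (\<And>y. y \<in> Y \<Longrightarrow> \<phi> y = 0) \<Longrightarrow> \<phi> = 0"
proof -
  obtain X where X: "finite X" "lie_subalgebra hull X = UNIV"
    using assms(1) by (auto simp: finitely_generated_def)
  have span: "span (monomials X) = UNIV"
    using X lie_subalgebra_hull_subset_span_monomials[of X] by auto
  \<comment> \<open>This covers all lengths below \<open>N\<close>; the bound \<open>\<le> N\<close>
    is the form in which lists over a finite set are known to be finite.\<close>
  define Y where "Y = nested_bracket ` {xs. set xs \<subseteq> X \<and> length xs \<le> N}"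
  show ?thesis
  proof (rule that[of Y])
    show "finite Y"
      using finite_lists_length_le[OF X(1)] by (simp add: Y_def)
    fix \<phi> assume der: "\<phi> \<in> Der N" and Y: "\<And>y. y \<in> Y \<Longrightarrow> \<phi> y = 0"
    have "\<phi> (nested_bracket xs) = 0" if "set xs \<subseteq> X" for xs
      using der assms(2) _ that
      by (rule Der_vanishes_on_monomials) (auto intro: Y simp: Y_def)
    then have "\<phi> x = 0" for x
      using vs.linear_eq_on[OF DerD(1)[OF der] vs.linear_zero, of x "monomials X"] span
      by (auto simp: monomials_def)
    then show "\<phi> = 0" by auto
  qed
qed

end

section \<open>Homogeneous components\<close>

context graded_lie_algebra
begin

interpretation vs: vector_space_pair scale scale
  by unfold_locales

lemma subspace_L: "subspace (L \<alpha>)"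
  using grading unfolding is_direct_sum_def by blast

text \<open>The projection onto \<open>L \<gamma>\<close>; the grading gives existence and
  uniqueness for the definite description.\<close>

definition component :: "'g \<Rightarrow> 'a \<Rightarrow> 'a" where
  "component \<gamma> x = (THE v. (\<forall>i. v i \<in> L i) \<and> finite {i. v i \<noteq> 0} \<and> x = (\<Sum>i | v i \<noteq> 0. v i)) \<gamma>"

lemma component_decomposition:
  shows component_in_L: "component \<gamma> x \<in> L \<gamma>"
    and finite_component: "finite {\<gamma>. component \<gamma> x \<noteq> 0}"
    and sum_component: "(\<Sum>\<gamma> | component \<gamma> x \<noteq> 0. component \<gamma> x) = x"
proof -
  have "\<exists>!v. (\<forall>i. v i \<in> L i) \<and> finite {i. v i \<noteq> 0} \<and> x = (\<Sum>i | v i \<noteq> 0. v i)"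
    using grading unfolding is_direct_sum_def by blast
  from theI'[OF this] show "component \<gamma> x \<in> L \<gamma>" "finite {\<gamma>. component \<gamma> x \<noteq> 0}"
    "(\<Sum>\<gamma> | component \<gamma> x \<noteq> 0. component \<gamma> x) = x"
    by (auto simp: component_def)
qed

text \<open>Lets elements with different supports be summed over one common finite index
  set.\<close>

lemma sum_component_superset:
  assumes "finite A" "\<And>\<gamma>. \<gamma> \<notin> A \<Longrightarrow> component \<gamma> x = 0"
  shows "(\<Sum>\<gamma>\<in>A. component \<gamma> x) = x"
proof -
  have "(\<Sum>\<gamma>\<in>A. component \<gamma> x) = (\<Sum>\<gamma> | component \<gamma> x \<noteq> 0. component \<gamma> x)"
    using assms by (intro sum.mono_neutral_right) auto
  then show ?thesis
    by (simp only: sum_component)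
qed

text \<open>Uniqueness in the grading: components are computed below by exhibiting a decomposition.
  \<open>A\<close> may exceed the support of \<open>v\<close>.\<close>

lemma component_eqI:
  assumes "\<And>i. v i \<in> L i" "finite A" "\<And>i. i \<notin> A \<Longrightarrow> v i = 0" "x = sum v A"
  shows "component \<gamma> x = v \<gamma>"
proof -
  have "\<exists>!v. (\<forall>i. v i \<in> L i) \<and> finite {i. v i \<noteq> 0} \<and> x = (\<Sum>i | v i \<noteq> 0. v i)"
    using grading unfolding is_direct_sum_def by blast
  moreover have "finite {i. v i \<noteq> 0}"
    using assms by (auto intro: finite_subset[of _ A])
  moreover have "x = (\<Sum>i | v i \<noteq> 0. v i)"
    unfolding assms(4) using assms(2,3) by (intro sum.mono_neutral_right) auto
  ultimately show ?thesis
    unfolding component_def using assms(1) by (subst the1_equality[where a = v]) auto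
qed

lemma component_add: "component \<gamma> (x + y) = component \<gamma> x + component \<gamma> y"
proof (rule component_eqI[where v = "\<lambda>i. component i x + component i y"])
  let ?A = "{\<gamma>. component \<gamma> x \<noteq> 0} \<union> {\<gamma>. component \<gamma> y \<noteq> 0}"
  show "component i x + component i y \<in> L i" for i
    by (simp add: subspace_L subspace_add component_in_L)
  show "finite ?A"
    by (simp add: finite_component)
  then have "(\<Sum>i\<in>?A. component i x) = x" "(\<Sum>i\<in>?A. component i y) = y"
    by (rule sum_component_superset; simp)+
  then show "x + y = (\<Sum>i\<in>?A. component i x + component i y)"
    by (simp only: sum.distrib)
qed auto

lemma component_scale: "component \<gamma> (scale c x) = scale c (component \<gamma> x)"
proof (rule component_eqI[where v = "\<lambda>i. scale c (component i x)"])
  show "scale c (component i x) \<in> L i" for i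
    by (simp add: subspace_L subspace_scale component_in_L)
  show "scale c x = (\<Sum>i | component i x \<noteq> 0. scale c (component i x))"
    by (simp add: scale_sum_right[symmetric] sum_component)
qed (auto simp: finite_component)

lemma linear_component: "Vector_Spaces.linear scale scale (component \<gamma>)"
  by (simp add: Vector_Spaces.linear_iff vector_space_axioms component_add component_scale)

lemma component_homogeneous:
  assumes "x \<in> L \<beta>"
  shows "component \<gamma> x = (if \<gamma> = \<beta> then x else 0)"
  by (rule component_eqI[of "\<lambda>\<gamma>. if \<gamma> = \<beta> then x else 0" "{\<beta>}"])
    (use assms in \<open>auto simp: subspace_0 subspace_L\<close>)

lemma span_homogeneous: "span (\<Union>\<alpha>. L \<alpha>) = UNIV"
proof -
  have "(\<Sum>\<gamma> | component \<gamma> x \<noteq> 0. component \<gamma> x) \<in> span (\<Union>\<alpha>. L \<alpha>)" for x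
    by (intro span_sum span_base) (auto intro: component_in_L)
  then show ?thesis
    by (auto simp: sum_component)
qed

lemma linear_eq_on_homogeneous:
  assumes "Vector_Spaces.linear scale scale f" "Vector_Spaces.linear scale scale g"
    and "\<And>\<beta> x. x \<in> L \<beta> \<Longrightarrow> f x = g x"
  shows "f = g"
  using vs.linear_eq_on[OF assms(1,2), of _ "\<Union>\<alpha>. L \<alpha>"] assms(3) span_homogeneous by auto

section \<open>Components of brackets\<close>

text \<open>Bracketing with \<open>x\<close> raises degrees by \<beta>, so the brackets of
  \<open>x\<close> with the components of \<open>y\<close> decompose
  \<open>bracket x y\<close>.\<close>

lemma component_bracket_left:
  assumes "x \<in> L \<beta>"
  shows "component (\<beta> + \<gamma>) (bracket x y) = bracket x (component \<gamma> y)"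
proof -
  let ?v = "\<lambda>\<delta>. bracket x (component (\<delta> - \<beta>) y)"
  let ?S = "{\<gamma>. component \<gamma> y \<noteq> 0}"
  have "component (\<beta> + \<gamma>) (bracket x y) = ?v (\<beta> + \<gamma>)"
  proof (rule component_eqI)
    show "?v \<delta> \<in> L \<delta>" for \<delta>
      using bracket_graded[OF assms component_in_L[of "\<delta> - \<beta>" y]] by simp
    show "finite ((+) \<beta> ` ?S)"
      by (simp add: finite_component)
    show "?v \<delta> = 0" if "\<delta> \<notin> (+) \<beta> ` ?S" for \<delta>
    proof -
      have "\<delta> = \<beta> + (\<delta> - \<beta>)" by simp
      with that have "component (\<delta> - \<beta>) y = 0" by blast
      then show ?thesis by (simp add: bracket_zero_right)
    qed
    show "bracket x y = sum ?v ((+) \<beta> ` ?S)"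
      by (simp add: sum.reindex bracket_sum_right[symmetric] sum_component)
  qed
  then show ?thesis by simp
qed

lemma component_bracket_right:
  assumes "x \<in> L \<beta>"
  shows "component (\<gamma> + \<beta>) (bracket y x) = bracket (component \<gamma> y) x"
  using component_bracket_left[OF assms, of \<gamma> y] bracket_anticommute[of y x]
    bracket_anticommute[of "component \<gamma> y" x] vs.linear_neg[OF linear_component]
  by (simp add: add.commute)

lemma nested_bracket_in_L:
  assumes "list_all2 (\<lambda>x \<beta>. x \<in> L \<beta>) xs \<beta>s" "xs \<noteq> []"
  shows "nested_bracket xs \<in> L (sum_list \<beta>s)"
  using assms
proof (induction rule: list_all2_induct)
  case (Cons x xs \<beta> \<beta>s)
  then show ?case
    by (cases "xs = []") (auto simp: nested_bracket_Cons bracket_graded)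
qed simp

text \<open>All slots other than \<open>k\<close> hold homogeneous entries, so fixing the total
  degree fixes the degree taken in slot \<open>k\<close>. \<open>sum_list \<beta>s\<close> still
  counts the degree of the replaced entry, hence \<open>\<alpha> + \<beta>s ! k\<close>.\<close>

lemma component_nested_bracket:
  assumes "list_all2 (\<lambda>x \<beta>. x \<in> L \<beta>) xs \<beta>s" "k < length xs"
  shows "component (\<alpha> + sum_list \<beta>s) (nested_bracket (xs[k := y])) =
    nested_bracket (xs[k := component (\<alpha> + \<beta>s ! k) y])"
  using assms
proof (induction arbitrary: k rule: list_all2_induct)
  case (Cons x xs \<beta> \<beta>s)
  show ?case
  proof (cases "xs = []")
    case True
    with Cons show ?thesis by auto
  next
    case xs: False
    show ?thesis
    proof (cases k)
      case 0
      with xs Cons show ?thesis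
        using component_bracket_right[OF nested_bracket_in_L[OF Cons(2) xs], of "\<alpha> + \<beta>" y]
        by (simp add: nested_bracket_Cons add.assoc)
    next
      case (Suc j)
      with xs Cons show ?thesis
        using component_bracket_left[OF Cons(1), of "\<alpha> + sum_list \<beta>s" "nested_bracket (xs[j := y])"]
        by (simp add: nested_bracket_Cons add.left_commute)
    qed
  qed
qed simp

section \<open>Homogeneous parts of a linear map\<close>

text \<open>Summing over the support of \<open>x\<close> keeps the sum finite and defines the part
  on all elements at once, not only on homogeneous ones.\<close>

definition part :: "('a \<Rightarrow> 'a) \<Rightarrow> 'g \<Rightarrow> 'a \<Rightarrow> 'a" where
  "part \<phi> \<alpha> x = (\<Sum>\<beta> | component \<beta> x \<noteq> 0. component (\<alpha> + \<beta>) (\<phi> (component \<beta> x)))"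

context
  fixes \<phi>
  assumes lin: "Vector_Spaces.linear scale scale \<phi>"
begin

lemma part_superset:
  assumes "finite A" "\<And>\<beta>. \<beta> \<notin> A \<Longrightarrow> component \<beta> x = 0"
  shows "part \<phi> \<alpha> x = (\<Sum>\<beta>\<in>A. component (\<alpha> + \<beta>) (\<phi> (component \<beta> x)))"
  unfolding part_def using assms
  by (intro sum.mono_neutral_left)
    (auto simp: vs.linear_0[OF lin] vs.linear_0[OF linear_component])

lemma linear_part: "Vector_Spaces.linear scale scale (part \<phi> \<alpha>)"
proof -
  have "part \<phi> \<alpha> (x + y) = part \<phi> \<alpha> x + part \<phi> \<alpha> y" for x y
  proof -
    let ?A = "{\<gamma>. component \<gamma> x \<noteq> 0} \<union> {\<gamma>. component \<gamma> y \<noteq> 0}"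
    have A: "finite ?A" by (simp add: finite_component)
    \<comment> \<open>One index set containing the supports of \<open>x\<close>, \<open>y\<close>
      and \<open>x + y\<close> allows termwise addition.\<close>
    have "part \<phi> \<alpha> z = (\<Sum>\<beta>\<in>?A. component (\<alpha> + \<beta>) (\<phi> (component \<beta> z)))"
      if "z \<in> {x, y, x + y}" for z
      using that by (intro part_superset A) (auto simp: component_add)
    then show ?thesis
      by (simp only: insertI1 insertI2 component_add vs.linear_add[OF lin] sum.distrib)
  qed
  moreover have "part \<phi> \<alpha> (scale c x) = scale c (part \<phi> \<alpha> x)" for c x
  proof -
    have "part \<phi> \<alpha> (scale c x) =
      (\<Sum>\<beta> | component \<beta> x \<noteq> 0. component (\<alpha> + \<beta>) (\<phi> (component \<beta> (scale c x))))"
      by (intro part_superset finite_component) (auto simp: component_scale)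
    then show ?thesis
      by (simp only: component_scale vs.linear_scale[OF lin] part_def[of \<phi> \<alpha> x] scale_sum_right)
  qed
  ultimately show ?thesis
    by (simp add: Vector_Spaces.linear_iff vector_space_axioms)
qed

lemma part_homogeneous:
  assumes "x \<in> L \<beta>"
  shows "part \<phi> \<alpha> x = component (\<alpha> + \<beta>) (\<phi> x)"
proof -
  have "part \<phi> \<alpha> x = (\<Sum>\<beta>\<in>{\<beta>}. component (\<alpha> + \<beta>) (\<phi> (component \<beta> x)))"
    by (rule part_superset) (simp_all add: component_homogeneous[OF assms])
  then show ?thesis
    by (simp add: component_homogeneous[OF assms])
qed

text \<open>If the part at \<alpha> is nonzero at \<open>x\<close>, then some \<beta> in the support
  of \<open>x\<close> has \<open>\<alpha> + \<beta>\<close> in the support of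
  \<open>\<phi> (component \<beta> x)\<close>. Only finitely many differences \<alpha> arise in this
  way.\<close>

lemma finite_part_neq_0: "finite {\<alpha>. part \<phi> \<alpha> x \<noteq> 0}"
proof (rule finite_subset)
  let ?S = "{\<beta>. component \<beta> x \<noteq> 0}"
  let ?T = "\<lambda>\<beta>. {\<gamma>. component \<gamma> (\<phi> (component \<beta> x)) \<noteq> 0}"
  show "finite (\<Union>\<beta>\<in>?S. (\<lambda>\<gamma>. \<gamma> - \<beta>) ` ?T \<beta>)"
    by (intro finite_UN_I finite_imageI finite_component)
  show "{\<alpha>. part \<phi> \<alpha> x \<noteq> 0} \<subseteq> (\<Union>\<beta>\<in>?S. (\<lambda>\<gamma>. \<gamma> - \<beta>) ` ?T \<beta>)"
  proof
    fix \<alpha> assume "\<alpha> \<in> {\<alpha>. part \<phi> \<alpha> x \<noteq> 0}"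
    then obtain \<beta> where "\<beta> \<in> ?S" "\<alpha> + \<beta> \<in> ?T \<beta>"
      unfolding part_def by (auto elim: sum.not_neutral_contains_not_neutral)
    moreover have "\<alpha> = \<alpha> + \<beta> - \<beta>" by simp
    ultimately show "\<alpha> \<in> (\<Union>\<beta>\<in>?S. (\<lambda>\<gamma>. \<gamma> - \<beta>) ` ?T \<beta>)" by blast
  qed
qed

text \<open>At \<open>x\<close> of degree \<beta> the values of the parts are the components of
  \<open>\<phi> x\<close>, with the index shifted by \<beta>.\<close>

lemma sum_part:
  assumes "finite A" "\<And>\<alpha>. \<alpha> \<notin> A \<Longrightarrow> part \<phi> \<alpha> = 0"
  shows "(\<Sum>\<alpha>\<in>A. part \<phi> \<alpha>) = \<phi>"
proof -
  have "(\<lambda>x. \<Sum>\<alpha>\<in>A. part \<phi> \<alpha> x) = \<phi>"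
  proof (rule linear_eq_on_homogeneous)
    fix \<beta> x assume x: "x \<in> L \<beta>"
    have "component \<gamma> (\<phi> x) = 0" if "\<gamma> \<notin> (\<lambda>\<alpha>. \<alpha> + \<beta>) ` A" for \<gamma>
    proof -
      have "\<gamma> = (\<gamma> - \<beta>) + \<beta>" by simp
      with that have "\<gamma> - \<beta> \<notin> A" by blast
      then have "part \<phi> (\<gamma> - \<beta>) x = 0" by (simp add: assms)
      then show ?thesis by (simp add: part_homogeneous[OF x])
    qed
    then have "(\<Sum>\<gamma>\<in>(\<lambda>\<alpha>. \<alpha> + \<beta>) ` A. component \<gamma> (\<phi> x)) = \<phi> x"
      using assms by (intro sum_component_superset) auto
    then show "(\<Sum>\<alpha>\<in>A. part \<phi> \<alpha> x) = \<phi> x"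
      by (simp add: part_homogeneous[OF x] sum.reindex)
  qed (auto intro: vs.linear_compose_sum linear_part lin)
  then show ?thesis
    by (simp add: fun_eq_iff sum_fun_apply)
qed

end

section \<open>Existence and uniqueness of the decomposition\<close>

text \<open>\<open>N \<noteq> 0\<close> makes the argument list nonempty, so that its bracket is
  homogeneous of degree \<open>sum_list \<beta>s\<close> and \<open>part_homogeneous\<close> applies
  to it.\<close>

lemma part_in_Der_deg:
  assumes "\<phi> \<in> Der N" "N \<noteq> 0"
  shows "part \<phi> \<alpha> \<in> Der_deg N \<alpha>"
proof -
  note lin = DerD(1)[OF assms(1)]
  have "part \<phi> \<alpha> \<in> Der N"
  proof (rule Der_if_spanning[OF linear_part[OF lin] span_homogeneous])
    fix xs :: "'a list" assume len: "length xs = N" and "set xs \<subseteq> (\<Union>\<alpha>. L \<alpha>)"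
    then have "\<forall>i<length xs. \<exists>\<beta>. xs ! i \<in> L \<beta>"
      by (metis UN_E nth_mem subsetD)
    \<comment> \<open>A degree has to be chosen for each entry, since 0 lies in every
      \<open>L \<beta>\<close>.\<close>
    then obtain \<beta> where "\<forall>i<length xs. xs ! i \<in> L (\<beta> i)" by metis
    define \<beta>s where "\<beta>s = map \<beta> [0..<N]"
    have hom: "list_all2 (\<lambda>x \<beta>. x \<in> L \<beta>) xs \<beta>s"
      using \<open>\<forall>i<length xs. xs ! i \<in> L (\<beta> i)\<close> len by (simp add: list_all2_conv_all_nth \<beta>s_def)
    have "part \<phi> \<alpha> (nested_bracket xs) = component (\<alpha> + sum_list \<beta>s) (\<phi> (nested_bracket xs))"
      using part_homogeneous[OF lin nested_bracket_in_L[OF hom]] len \<open>N \<noteq> 0\<close> by auto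
    also have "\<dots> = (\<Sum>i<N. component (\<alpha> + sum_list \<beta>s) (nested_bracket (xs[i := \<phi> (xs ! i)])))"
      by (simp add: DerD(2)[OF assms(1) len] vs.linear_sum[OF linear_component])
    \<comment> \<open>The projection moves into slot \<open>i\<close>, where it turns
      \<open>\<phi> (xs ! i)\<close> into the value of the part.\<close>
    also have "\<dots> = (\<Sum>i<N. nested_bracket (xs[i := part \<phi> \<alpha> (xs ! i)]))"
    proof (rule sum.cong)
      fix i assume "i \<in> {..<N}"
      then have i: "i < length xs" using len by simp
      then have "xs ! i \<in> L (\<beta>s ! i)"
        using hom by (rule list_all2_nthD[rotated])
      then show "component (\<alpha> + sum_list \<beta>s) (nested_bracket (xs[i := \<phi> (xs ! i)])) =
          nested_bracket (xs[i := part \<phi> \<alpha> (xs ! i)])"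
        by (simp add: component_nested_bracket[OF hom i] part_homogeneous[OF lin])
    qed simp
    finally show "part \<phi> \<alpha> (nested_bracket xs) =
      (\<Sum>i<N. nested_bracket (xs[i := part \<phi> \<alpha> (xs ! i)]))" .
  qed
  then show ?thesis
    by (auto simp: Der_deg_def part_homogeneous[OF lin] component_in_L)
qed

text \<open>For \<open>x\<close> of degree \<beta>, the values \<open>v \<alpha> x\<close> lie in
  degrees \<open>\<alpha> + \<beta>\<close> and sum to \<open>\<phi> x\<close>, so they are the
  components of \<open>\<phi> x\<close>, just as the values of the parts are.\<close>

lemma part_unique:
  assumes hom: "\<And>\<alpha>. v \<alpha> \<in> Der_deg N \<alpha>" and "finite A" "\<And>\<alpha>. \<alpha> \<notin> A \<Longrightarrow> v \<alpha> = 0"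
    and \<phi>: "\<phi> \<in> Der N" "\<phi> = (\<Sum>\<alpha>\<in>A. v \<alpha>)"
  shows "v = part \<phi>"
proof
  fix \<alpha>
  note lin = DerD(1)[OF \<phi>(1)]
  show "v \<alpha> = part \<phi> \<alpha>"
  proof (rule linear_eq_on_homogeneous[OF _ linear_part[OF lin]])
    show "Vector_Spaces.linear scale scale (v \<alpha>)"
      using hom[of \<alpha>] by (auto simp: Der_deg_def intro: DerD)
    fix \<beta> x assume x: "x \<in> L \<beta>"
    \<comment> \<open>The argument stays \<open>\<alpha> + \<beta> - \<beta>\<close> to match the
      family \<open>v (\<gamma> - \<beta>) x\<close> at
      \<open>\<gamma> = \<alpha> + \<beta>\<close>.\<close>
    have "component (\<alpha> + \<beta>) (\<phi> x) = v (\<alpha> + \<beta> - \<beta>) x"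
    proof (rule component_eqI[of "\<lambda>\<gamma>. v (\<gamma> - \<beta>) x" "(\<lambda>\<alpha>. \<alpha> + \<beta>) ` A"])
      show "v (\<gamma> - \<beta>) x \<in> L \<gamma>" for \<gamma>
      proof -
        have "v (\<gamma> - \<beta>) x \<in> L (\<gamma> - \<beta> + \<beta>)"
          using hom[of "\<gamma> - \<beta>"] x unfolding Der_deg_def by blast
        then show ?thesis by simp
      qed
      show "v (\<gamma> - \<beta>) x = 0" if "\<gamma> \<notin> (\<lambda>\<alpha>. \<alpha> + \<beta>) ` A" for \<gamma>
      proof -
        have "\<gamma> = (\<gamma> - \<beta>) + \<beta>" by simp
        with that have "\<gamma> - \<beta> \<notin> A" by blast
        then show ?thesis by (simp add: assms)
      qed
      show "\<phi> x = (\<Sum>\<gamma>\<in>(\<lambda>\<alpha>. \<alpha> + \<beta>) ` A. v (\<gamma> - \<beta>) x)"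
        by (simp add: \<phi>(2) sum_fun_apply sum.reindex)
    qed (use \<open>finite A\<close> in simp)
    then show "v \<alpha> x = part \<phi> \<alpha> x"
      by (simp add: part_homogeneous[OF lin x])
  qed
qed

lemma subspace_Der_deg: "module.subspace (fun_scale scale) (Der_deg N \<alpha>)"
proof -
  interpret F: vector_space "fun_scale scale"
    by (rule vector_space_fun_scale) unfold_locales
  have "F.subspace {\<phi>. \<forall>\<beta>. \<phi> ` L \<beta> \<subseteq> L (\<alpha> + \<beta>)}"
    using subspace_0[OF subspace_L] subspace_add[OF subspace_L] subspace_scale[OF subspace_L]
    by (auto simp: F.subspace_def fun_scale_def image_subset_iff)
  from F.subspace_inter[OF subspace_Der[of N] this] show ?thesis
    by (simp add: Der_deg_def Int_def)
qed

text \<open>Finite generation enters through the finite set \<open>Y\<close>, which leaves only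
  finitely many nonzero parts.\<close>

lemma is_direct_sum_Der:
  assumes finitely_generated and "N \<ge> 2"
  shows "is_direct_sum (fun_scale scale) (Der N) (Der_deg N)"
  unfolding is_direct_sum_def
proof (intro conjI allI ballI)
  fix \<phi> assume \<phi>: "\<phi> \<in> Der N"
  note lin = DerD(1)[OF \<phi>]
  have part: "part \<phi> \<alpha> \<in> Der_deg N \<alpha>" for \<alpha>
    using part_in_Der_deg[OF \<phi>] \<open>N \<ge> 2\<close> by simp
  obtain Y where Y: "finite Y"
    "\<And>\<phi>. \<phi> \<in> Der N \<Longrightarrow> (\<And>y. y \<in> Y \<Longrightarrow> \<phi> y = 0) \<Longrightarrow> \<phi> = 0"
    using Der_determined_by_finite_set[OF assms] by metis
  \<comment> \<open>A nonzero part, being an \<open>N\<close>-derivation, is nonzero at some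
    \<open>y\<close> in \<open>Y\<close>.\<close>
  have "{\<alpha>. part \<phi> \<alpha> \<noteq> 0} \<subseteq> (\<Union>y\<in>Y. {\<alpha>. part \<phi> \<alpha> y \<noteq> 0})"
    using Y(2) part by (fastforce simp: Der_deg_def)
  then have fin: "finite {\<alpha>. part \<phi> \<alpha> \<noteq> 0}"
    by (rule finite_subset) (simp add: Y finite_part_neq_0[OF lin])
  show "\<exists>!v. (\<forall>\<alpha>. v \<alpha> \<in> Der_deg N \<alpha>) \<and> finite {\<alpha>. v \<alpha> \<noteq> 0} \<and> \<phi> = (\<Sum>\<alpha> | v \<alpha> \<noteq> 0. v \<alpha>)"
  proof (rule ex1I)
    show "(\<forall>\<alpha>. part \<phi> \<alpha> \<in> Der_deg N \<alpha>) \<and> finite {\<alpha>. part \<phi> \<alpha> \<noteq> 0} \<and>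
        \<phi> = (\<Sum>\<alpha> | part \<phi> \<alpha> \<noteq> 0. part \<phi> \<alpha>)"
      using part fin sum_part[OF lin fin] by simp
    fix v assume v: "(\<forall>\<alpha>. v \<alpha> \<in> Der_deg N \<alpha>) \<and> finite {\<alpha>. v \<alpha> \<noteq> 0} \<and> \<phi> = (\<Sum>\<alpha> | v \<alpha> \<noteq> 0. v \<alpha>)"
    show "v = part \<phi>"
      by (rule part_unique[of v N "{\<alpha>. v \<alpha> \<noteq> 0}"]) (use v \<phi> in auto)
  qed
qed (simp_all add: subspace_Der subspace_Der_deg, auto simp: Der_deg_def)

end

theorem lemma2p1:
  fixes scale :: "'f::field \<Rightarrow> 'a::ab_group_add \<Rightarrow> 'a"
    and bracket :: "'a \<Rightarrow> 'a \<Rightarrow> 'a"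
    and L :: "'g::ab_group_add \<Rightarrow> 'a set"
    and N :: nat
  assumes "graded_lie_algebra scale bracket L"
    and "lie_algebra.finitely_generated scale bracket"
    and "N \<ge> 2"
  shows "is_direct_sum (fun_scale scale)
           (lie_algebra.Der scale bracket N)
           (\<lambda>\<alpha>::'g. graded_lie_algebra.Der_deg scale bracket L N \<alpha>)"
  using graded_lie_algebra.is_direct_sum_Der[OF assms] .

end
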